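(* Let $x,y,q$ be complex numbers with $|q|<1$. Then \[ \sum_{i,j\ge 0}\frac{x^{i+j}y^{i+2j}q^{i^2+2ij+2j^2+j}}{(q;q)_i(q^2;q^2)_j} = (-yq;q)_{\infty}\sum_{n\ge 0}\frac{(-1)^ny^nq^n(x;q^2)_n}{(q;q)_n}. \]
   Context: For $|q|<1$: $(a;q)_0=1$, $(a;q)_n=(1-a)(1-aq)\cdots(1-aq^{n-1})$ for $n\ge1$, and $(a;q)_\infty=\lim_{n\to\infty}(a;q)_n$.
   Formalization: The identity is proved under the added hypothesis that the series over n on the right converges (true when |yq|<1 or when it terminates); otherwise, e.g. x=0, q=1/2, y=2, that series diverges and the right side is undefined. *)

theory Defs
  imports "HOL-Analysis.Analysis"
begin

definition qpoch :: "complex \<Rightarrow> complex \<Rightarrow> nat \<Rightarrow> complex" where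
  "qpoch a q n = (\<Prod>k<n. 1 - a * q ^ k)"

definition qpoch_inf :: "complex \<Rightarrow> complex \<Rightarrow> complex" where
  "qpoch_inf a q = lim (\<lambda>n. qpoch a q n)"

text \<open>
  The terms of the single series below have ratio tending to \<open>-y * q\<close>. Hence the series
  converges for \<open>norm (y * q) < 1\<close>; for \<open>norm (y * q) \<ge> 1\<close> it diverges unless
  \<open>qpoch x (q\<^sup>2) n\<close> vanishes for some \<open>n\<close>, in which case it is a finite sum.
\<close>

lemma summable_qpoch_series:
  fixes x y q :: complex
  assumes q: "norm q < 1" and yq: "norm (y * q) < 1"
  shows "summable (\<lambda>n. (-1) ^ n * y ^ n * q ^ n * qpoch x (q\<^sup>2) n / qpoch q q n)"
proof -
  define f where "f = (\<lambda>n. (-1) ^ n * y ^ n * q ^ n * qpoch x (q\<^sup>2) n / qpoch q q n)"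
  define r where "r = (\<lambda>n. - (y * q) * (1 - x * (q\<^sup>2) ^ n) / (1 - q * q ^ n))"
  have step: "f (Suc n) = r n * f n" for n
    by (simp add: f_def r_def qpoch_def divide_simps)
  have "norm (q\<^sup>2) < 1"
    using q by (simp add: norm_power power_less_one_iff)
  then have "r \<longlonglongrightarrow> - (y * q) * (1 - x * 0) / (1 - q * 0)"
    unfolding r_def using q by (intro tendsto_intros LIMSEQ_power_zero) auto
  then have "(\<lambda>n. norm (r n)) \<longlonglongrightarrow> norm (y * q)"
    using tendsto_norm by fastforce
  moreover obtain c where c: "norm (y * q) < c" "c < 1"
    using yq dense by blast
  ultimately have "eventually (\<lambda>n. norm (r n) < c) sequentially"
    by (simp add: order_tendstoD(2))
  then obtain N where N: "\<And>n. n \<ge> N \<Longrightarrow> norm (r n) < c"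
    by (auto simp: eventually_sequentially)
  have "summable f"
  proof (rule summable_ratio_test[OF c(2), of N])
    fix n assume "N \<le> n"
    then show "norm (f (Suc n)) \<le> c * norm (f n)"
      unfolding step norm_mult using N[of n] by (simp add: mult_right_mono)
  qed
  then show ?thesis by (simp add: f_def)
qed

end

theory Submission
  imports Defs
begin

text \<open>
  Both sides, as functions \<open>G\<close> of \<open>y\<close>, satisfy the \<open>q\<close>-difference equation
  \<open>G(y) = G(qy) + xqy (1 + q\<^sup>2y) G(q\<^sup>2y)\<close>, and both tend to \<open>1\<close> along \<open>y, qy, q\<^sup>2y, \<dots>\<close>.
  Along this sequence the coefficients of the difference equation are summable, so a solution that
  tends to \<open>0\<close> vanishes, and the two sides agree. The equation only involves points \<open>q\<^sup>n y\<close>, where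
  the single series converges as soon as it does at \<open>y\<close>; so there is no need to distinguish
  the case \<open>norm (y * q) < 1\<close> from the terminating one.
\<close>

section \<open>Uniqueness for the recurrence, and a ratio test\<close>

text \<open>A backward Gronwall argument: far out \<open>a\<close> is at most \<open>d\<close> in
  norm, and each step back costs at most a factor \<open>1 + norm (c m)\<close>, hence
  \<open>exp (norm (c m))\<close>. Summability keeps the accumulated factor bounded, and
  \<open>d\<close> is arbitrary.\<close>

lemma second_order_recurrence_zero:
  fixes a c :: "nat \<Rightarrow> 'a::real_normed_algebra"
  assumes rec: "\<And>n. a n = a (Suc n) + c n * a (Suc (Suc n))"
    and c: "summable (\<lambda>n. norm (c n))"
    and a: "a \<longlonglongrightarrow> 0"
  shows "a n = 0"
proof -
  define s where "s = (\<lambda>m. \<Sum>k. norm (c (k + m)))"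
  have summ: "summable (\<lambda>k. norm (c (k + m)))" for m
    using c by (subst summable_iff_shift)
  have s_Suc: "s m = norm (c m) + s (Suc m)" for m
    using suminf_split_head[OF summ, of m] by (simp add: s_def)
  have s_nonneg: "0 \<le> s m" for m
    unfolding s_def by (intro suminf_nonneg summ) auto
  have bound: "norm (a m) \<le> d * exp (s m)" if d: "d > 0" for d m
  proof -
    obtain N where N: "\<And>m. m \<ge> N \<Longrightarrow> norm (a m) \<le> d"
      using LIMSEQ_D[OF a d] by (force simp: less_imp_le)
    show ?thesis
    \<comment> \<open>Descending induction from \<open>N\<close>; all \<open>m\<close> beyond
      \<open>N\<close> form the base case.\<close>
    proof (induction "N - m" arbitrary: m rule: less_induct)
      case less
      show ?case
      proof (cases "m \<ge> N")
        case True
        have "d * 1 \<le> d * exp (s m)"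
          using d s_nonneg by (intro mult_left_mono) auto
        with N[OF True] show ?thesis by simp
      next
        case False
        let ?E = "d * exp (s (Suc m))"
        have 1: "norm (a (Suc m)) \<le> ?E"
          using less[of "Suc m"] False by simp
        have "norm (a (Suc (Suc m))) \<le> d * exp (s (Suc (Suc m)))"
          using less[of "Suc (Suc m)"] False by simp
        \<comment> \<open>Tail sums decrease, so one bound \<open>?E\<close> serves both later
          terms.\<close>
        also have "\<dots> \<le> ?E"
          using d s_Suc[of "Suc m"] by (intro mult_left_mono) auto
        finally have 2: "norm (a (Suc (Suc m))) \<le> ?E" .
        have "norm (a m) \<le> norm (a (Suc m)) + norm (c m) * norm (a (Suc (Suc m)))"
          using norm_triangle_ineq[of "a (Suc m)" "c m * a (Suc (Suc m))"]
            norm_mult_ineq[of "c m" "a (Suc (Suc m))"] rec[of m] by simp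
        also have "\<dots> \<le> ?E + norm (c m) * ?E"
          by (intro add_mono mult_left_mono 1 2) auto
        also have "\<dots> = (1 + norm (c m)) * ?E"
          by (simp add: algebra_simps)
        also have "\<dots> \<le> exp (norm (c m)) * ?E"
          using d by (intro mult_right_mono) auto
        also have "\<dots> = d * exp (s m)"
          by (simp add: s_Suc[of m] exp_add)
        finally show ?thesis .
      qed
    qed
  qed
  have "norm (a n) \<le> 0"
  proof (rule field_le_epsilon)
    fix e :: real assume "e > 0"
    then show "norm (a n) \<le> 0 + e"
      using bound[of "e / exp (s n)" n] by simp
  qed
  then show ?thesis by simp
qed

text \<open>The ratio enters through a recursion, not as a quotient, so that \<open>f\<close> may
  vanish, as it does for \<open>x = 0\<close> or \<open>q = 0\<close>.\<close>

lemma summable_norm_ratio_zero: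
  fixes f r :: "nat \<Rightarrow> 'a::real_normed_field"
  assumes step: "\<And>n. f (Suc n) = r n * f n" and r: "r \<longlonglongrightarrow> 0"
  shows "summable (\<lambda>n. norm (f n))"
proof -
  obtain N where N: "\<And>n. n \<ge> N \<Longrightarrow> norm (r n) < 1/2"
    using LIMSEQ_D[OF r, of "1/2"] by auto
  show ?thesis
  proof (rule summable_ratio_test[of "1/2" N])
    fix n assume "n \<ge> N"
    then show "norm (norm (f (Suc n))) \<le> 1/2 * norm (norm (f n))"
      using mult_right_mono[OF less_imp_le[OF N] norm_ge_zero, of n "f n"]
      by (simp add: step norm_mult)
  qed simp
qed

lemma one_minus_power_Suc_neq_0:
  fixes q :: complex
  assumes "norm q < 1"
  shows "1 - q * q ^ n \<noteq> 0"
proof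
  assume "1 - q * q ^ n = 0"
  then have "q ^ Suc n = 1"
    by simp
  then have "norm q ^ Suc n = 1"
    by (metis norm_one norm_power)
  moreover have "norm q ^ Suc n < 1"
    using assms by (subst power_less_one_iff) auto
  ultimately show False
    by simp
qed

section \<open>Finite and infinite q-Pochhammer symbols\<close>

lemma qpoch_0 [simp]: "qpoch a q 0 = 1"
  by (simp add: qpoch_def)

lemma qpoch_Suc: "qpoch a q (Suc n) = qpoch a q n * (1 - a * q ^ n)"
  by (simp add: qpoch_def)

lemma qpoch_Suc_shift: "qpoch a q (Suc n) = (1 - a) * qpoch (a * q) q n"
  unfolding qpoch_def by (subst prod.lessThan_Suc_shift) (simp add: mult.assoc)

text \<open>The deviations \<open>a * q ^ k\<close> of the factors from 1 form an absolutely
  convergent geometric series, so the product converges and the \<open>lim\<close> in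
  \<open>qpoch_inf\<close> is a genuine limit.\<close>

lemma qpoch_LIMSEQ:
  assumes q: "norm q < 1"
  shows "qpoch a q \<longlonglongrightarrow> qpoch_inf a q"
proof -
  have "summable (\<lambda>k. norm (1 - a * q ^ k - 1))"
    using q by (simp add: norm_mult norm_power summable_mult summable_geometric)
  then have "convergent (\<lambda>n. \<Prod>k\<le>n. 1 - a * q ^ k)"
    by (intro abs_convergent_prod_imp_convergent_prod convergent_prod_imp_convergent
          summable_imp_abs_convergent_prod)
  then have "convergent (\<lambda>n. qpoch a q (Suc n))"
    by (simp add: qpoch_def lessThan_Suc_atMost)
  then have "convergent (qpoch a q)"
    by (simp add: convergent_Suc_iff)
  then show ?thesis
    by (simp add: qpoch_inf_def convergent_LIMSEQ_iff)
qed

lemma qpoch_inf_rec: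
  assumes q: "norm q < 1"
  shows "qpoch_inf a q = (1 - a) * qpoch_inf (a * q) q"
proof (rule LIMSEQ_unique)
  show "(\<lambda>n. qpoch a q (Suc n)) \<longlonglongrightarrow> qpoch_inf a q"
    using qpoch_LIMSEQ[OF q] by (rule LIMSEQ_Suc)
  show "(\<lambda>n. qpoch a q (Suc n)) \<longlonglongrightarrow> (1 - a) * qpoch_inf (a * q) q"
    unfolding qpoch_Suc_shift by (intro tendsto_mult_left qpoch_LIMSEQ q)
qed

text \<open>Expanding the product and taking norms gives at most
  \<open>(\<Prod>k<n. 1 + norm (a * q ^ k)) - 1\<close>, which \<open>exp\<close> of a geometric sum
  controls. The bound tends to 0 with \<open>a\<close>, which yields the limit at
  \<open>a = 0\<close>.\<close>

lemma norm_qpoch_inf_minus_1_le: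
  assumes q: "norm q < 1"
  shows "norm (qpoch_inf a q - 1) \<le> exp (norm a / (1 - norm q)) - 1"
proof (rule LIMSEQ_le_const2)
  show "(\<lambda>n. norm (qpoch a q n - 1)) \<longlonglongrightarrow> norm (qpoch_inf a q - 1)"
    by (intro tendsto_intros qpoch_LIMSEQ q)
  have "norm (qpoch a q n - 1) \<le> exp (norm a / (1 - norm q)) - 1" for n
  proof -
    have "norm (qpoch a q n - 1) \<le> (\<Prod>k<n. 1 + norm (- (a * q ^ k))) - 1"
      using norm_prod_minus1_le_prod_minus1[of "\<lambda>k. - (a * q ^ k)" "{..<n}"]
      by (simp add: qpoch_def)
    also have "\<dots> \<le> exp (\<Sum>k<n. norm (- (a * q ^ k))) - 1"
      by (intro diff_right_mono prod_le_exp_sum) auto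
    also have "(\<Sum>k<n. norm (- (a * q ^ k))) = norm a * (\<Sum>k<n. norm q ^ k)"
      by (simp add: norm_mult norm_power sum_distrib_left)
    also have "(\<Sum>k<n. norm q ^ k) \<le> (\<Sum>k. norm q ^ k)"
      using q by (intro sum_le_suminf summable_geometric) auto
    also have "\<dots> = 1 / (1 - norm q)"
      using q by (simp add: suminf_geometric)
    finally show ?thesis
      by (simp add: mult_left_mono)
  qed
  then show "\<exists>N. \<forall>n\<ge>N. norm (qpoch a q n - 1) \<le> exp (norm a / (1 - norm q)) - 1"
    by blast
qed

lemma qpoch_inf_tendsto_1:
  assumes q: "norm q < 1" and a: "(a \<longlongrightarrow> 0) F"
  shows "((\<lambda>n. qpoch_inf (a n) q) \<longlongrightarrow> 1) F"
proof -
  have "((\<lambda>n. exp (norm (a n) / (1 - norm q)) - 1) \<longlongrightarrow> exp (norm (0::complex) / (1 - norm q)) - 1) F"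
    using q by (intro tendsto_intros a) auto
  then have "((\<lambda>n. exp (norm (a n) / (1 - norm q)) - 1) \<longlongrightarrow> 0) F"
    by simp
  then have "((\<lambda>n. qpoch_inf (a n) q - 1) \<longlongrightarrow> 0) F"
    by (rule Lim_null_comparison[OF always_eventually, rotated])
      (use norm_qpoch_inf_minus_1_le[OF q] in blast)
  then show ?thesis
    by (simp add: LIM_zero_iff)
qed

section \<open>The single series and its difference equation\<close>

locale q_series =
  fixes x q :: complex
  assumes q: "norm q < 1"
begin

text \<open>The powers of \<open>y\<close> are split off so that results on power series in
  \<open>y\<close> apply.\<close>

definition single_coeff :: "nat \<Rightarrow> complex" where
  "single_coeff n = (-1) ^ n * q ^ n * qpoch x (q\<^sup>2) n / qpoch q q n"

definition single :: "complex \<Rightarrow> complex" where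
  "single y = (\<Sum>n. single_coeff n * y ^ n)"

lemma single_coeff_Suc:
  "single_coeff (Suc n) * (1 - q ^ Suc n) = - q * (1 - x * (q\<^sup>2) ^ n) * single_coeff n"
  using one_minus_power_Suc_neq_0[OF q, of n]
  by (simp add: single_coeff_def qpoch_Suc)

lemma summable_single_mult_q:
  assumes "summable (\<lambda>n. single_coeff n * y ^ n)"
  shows "summable (\<lambda>n. single_coeff n * (q * y) ^ n)"
\<comment> \<open>\<open>powser_inside\<close> needs the strict inequality
  \<open>norm (q * y) < norm y\<close>, which fails at 0.\<close>
proof (cases "y = 0")
  case False
  with q show ?thesis
    by (intro powser_inside[OF assms]) (simp add: norm_mult)
qed (use assms in simp)

lemma summable_single_mult_q_power:
  assumes "summable (\<lambda>n. single_coeff n * y ^ n)"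
  shows "summable (\<lambda>n. single_coeff n * (q ^ m * y) ^ n)"
proof (induction m)
  case (Suc m)
  then show ?case
    using summable_single_mult_q[OF Suc] by (simp add: mult.assoc)
qed (use assms in simp)

text \<open>Weighting the terms by \<open>1 - q ^ n\<close> gives
  \<open>single y - single (q * y)\<close>. By the recursion of the coefficients, the same series is
  a shifted combination of those for \<open>y\<close> and \<open>q\<^sup>2 * y\<close>.\<close>

lemma single_rec:
  assumes y: "summable (\<lambda>n. single_coeff n * y ^ n)"
  shows "(1 + q * y) * single y = single (q * y) + x * q * y * single (q\<^sup>2 * y)"
proof -
  have qy: "summable (\<lambda>n. single_coeff n * (q * y) ^ n)"
    and q2y: "summable (\<lambda>n. single_coeff n * (q\<^sup>2 * y) ^ n)"
    using y by (simp_all add: summable_single_mult_q summable_single_mult_q_power)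
  let ?f = "\<lambda>n. single_coeff n * (1 - q ^ n) * y ^ n"
  have f: "?f = (\<lambda>n. single_coeff n * y ^ n - single_coeff n * (q * y) ^ n)"
    by (simp add: fun_eq_iff algebra_simps power_mult_distrib)
  have "?f sums (single y - single (q * y))"
    unfolding f single_def by (intro sums_diff summable_sums y qy)
  moreover have "(\<lambda>n. ?f (Suc n)) sums (- q * y * (single y - x * single (q\<^sup>2 * y)))"
  proof -
    have eq: "?f (Suc n) =
        - q * y * (single_coeff n * y ^ n - x * (single_coeff n * (q\<^sup>2 * y) ^ n))" for n
      unfolding single_coeff_Suc by (simp add: algebra_simps power_mult_distrib)
    show ?thesis
      unfolding eq single_def by (intro sums_mult sums_diff summable_sums y q2y)
  qed
  \<comment> \<open>The shift loses nothing: \<open>?f 0 = 0\<close> because of the factor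
    \<open>1 - q ^ 0\<close>.\<close>
  then have "?f sums (- q * y * (single y - x * single (q\<^sup>2 * y)))"
    by (subst (asm) sums_Suc_iff) simp
  ultimately have "single y - single (q * y) = - q * y * (single y - x * single (q\<^sup>2 * y))"
    by (rule sums_unique2)
  then show ?thesis
    by (simp add: algebra_simps)
qed

lemma q_power_mult_tendsto_0: "(\<lambda>n. q ^ n * y) \<longlonglongrightarrow> 0"
  using tendsto_mult_left_zero[OF LIMSEQ_power_zero[OF q]] by simp

lemma single_tendsto_1:
  assumes y: "summable (\<lambda>n. single_coeff n * y ^ n)"
  shows "(\<lambda>n. single (q ^ n * y)) \<longlonglongrightarrow> 1"
proof -
  have 0: "single 0 = 1"
    by (simp only: single_def powser_zero) (simp add: single_coeff_def)
  show ?thesis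
  proof (cases "y = 0")
    case False
    have "isCont single 0"
      unfolding single_def using False by (intro isCont_powser[OF y]) auto
    then show ?thesis
      using isCont_tendsto_compose[OF _ q_power_mult_tendsto_0] 0 by metis
  qed (simp add: 0)
qed

section \<open>The double series and its difference equation\<close>

definition double_term :: "complex \<Rightarrow> nat \<times> nat \<Rightarrow> complex" where
  "double_term y = (\<lambda>(i, j). x ^ (i + j) * y ^ (i + 2 * j) * q ^ (i\<^sup>2 + 2 * i * j + 2 * j\<^sup>2 + j)
     / (qpoch q q i * qpoch (q\<^sup>2) (q\<^sup>2) j))"

definition double :: "complex \<Rightarrow> complex" where
  "double y = infsum (double_term y) UNIV"

lemma norm_q2: "norm (q\<^sup>2) < 1"
  using q by (simp add: norm_power power_less_one_iff)

text \<open>The only factor coupling \<open>i\<close> and \<open>j\<close> is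
  \<open>q ^ (2 * i * j)\<close>, of norm at most 1. Without it the term is a product
  \<open>A i * B j\<close>, and both sequences have ratios tending to 0 because their exponents of
  \<open>q\<close> are quadratic.\<close>

lemma double_term_abs_summable: "(\<lambda>p. norm (double_term y p)) summable_on UNIV"
proof -
  define A where "A = (\<lambda>i. (x * y) ^ i * q ^ i\<^sup>2 / qpoch q q i)"
  define B where "B = (\<lambda>j. (x * y\<^sup>2) ^ j * q ^ (2 * j\<^sup>2 + j) / qpoch (q\<^sup>2) (q\<^sup>2) j)"
  have sq: "(Suc n)\<^sup>2 = n\<^sup>2 + n + n + 1" for n
    by (simp add: power2_eq_square)
  have "summable (\<lambda>i. norm (A i))"
  proof (rule summable_norm_ratio_zero)
    show "A (Suc n) = (x * y * (q * q ^ n * q ^ n) / (1 - q * q ^ n)) * A n" for n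
      by (simp add: A_def sq qpoch_Suc power_add mult_ac)
    have "(\<lambda>n. x * y * (q * q ^ n * q ^ n) / (1 - q * q ^ n))
        \<longlonglongrightarrow> x * y * (q * 0 * 0) / (1 - q * 0)"
      by (intro tendsto_intros LIMSEQ_power_zero q) auto
    then show "(\<lambda>n. x * y * (q * q ^ n * q ^ n) / (1 - q * q ^ n)) \<longlonglongrightarrow> 0"
      by simp
  qed
  then have A: "(\<lambda>i. norm (A i)) summable_on UNIV"
    by (intro norm_summable_imp_summable_on) simp
  have "summable (\<lambda>j. norm (B j))"
  proof (rule summable_norm_ratio_zero)
    \<comment> \<open>The increment 4n + 3 is split so as to produce powers of
      \<open>q\<^sup>2\<close>.\<close>
    have e: "2 * (Suc n)\<^sup>2 + Suc n = 2 * n\<^sup>2 + n + (3 + 2 * n + 2 * n)" for n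
      by (simp add: sq)
    show "B (Suc n) = (x * y\<^sup>2 * (q ^ 3 * (q\<^sup>2) ^ n * (q\<^sup>2) ^ n) / (1 - q\<^sup>2 * (q\<^sup>2) ^ n)) * B n" for n
      unfolding B_def e unfolding qpoch_Suc power_add power_mult by (simp add: mult_ac)
    have "(\<lambda>n. x * y\<^sup>2 * (q ^ 3 * (q\<^sup>2) ^ n * (q\<^sup>2) ^ n) / (1 - q\<^sup>2 * (q\<^sup>2) ^ n))
        \<longlonglongrightarrow> x * y\<^sup>2 * (q ^ 3 * 0 * 0) / (1 - q\<^sup>2 * 0)"
      by (intro tendsto_mult tendsto_divide tendsto_diff tendsto_const
          LIMSEQ_power_zero norm_q2) auto
    then show "(\<lambda>n. x * y\<^sup>2 * (q ^ 3 * (q\<^sup>2) ^ n * (q\<^sup>2) ^ n) / (1 - q\<^sup>2 * (q\<^sup>2) ^ n)) \<longlonglongrightarrow> 0"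
      by simp
  qed
  then have B: "(\<lambda>j. norm (B j)) summable_on UNIV"
    by (intro norm_summable_imp_summable_on) simp
  have AB: "(\<lambda>p. norm ((\<lambda>(i, j). A i * B j) p)) summable_on UNIV \<times> UNIV"
    unfolding Infinite_Sum.abs_summable_on_Sigma_iff
    using A B by (simp add: norm_mult summable_on_cmult_right infsum_cmult_right
        summable_on_cmult_left abs_mult infsum_nonneg)
  show ?thesis
  proof (rule Infinite_Sum.abs_summable_on_comparison_test)
    show "(\<lambda>p. norm ((\<lambda>(i, j). A i * B j) p)) summable_on UNIV"
      using AB by simp
    fix p :: "nat \<times> nat"
    obtain i j where p: "p = (i, j)" by (cases p)
    have "q ^ (i\<^sup>2 + 2 * i * j + 2 * j\<^sup>2 + j) = q ^ (2 * i * j) * (q ^ i\<^sup>2 * q ^ (2 * j\<^sup>2 + j))"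
      by (simp only: add_ac flip: power_add)
    moreover have "x ^ (i + j) * y ^ (i + 2 * j) = (x * y) ^ i * (x * y\<^sup>2) ^ j"
      by (simp add: power_add power_mult_distrib mult_ac flip: power_mult)
    ultimately have "double_term y p = q ^ (2 * i * j) * (A i * B j)"
      unfolding p double_term_def A_def B_def prod.case
      by (simp only: times_divide_eq_left times_divide_eq_right divide_divide_eq_left mult_ac)
    moreover have "norm (q ^ (2 * i * j)) \<le> 1"
      using q by (simp add: norm_power power_le_one)
    ultimately show "norm (double_term y p) \<le> norm ((\<lambda>(i, j). A i * B j) p)"
      by (simp add: p norm_mult mult_left_le_one_le)
  qed
qed

lemma double_has_sum: "(double_term y has_sum double y) UNIV"
  unfolding double_def
  by (rule has_sum_infsum[OF abs_summable_summable[OF double_term_abs_summable]])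

lemma double_term_mult: "double_term (c * y) (i, j) = c ^ (i + 2 * j) * double_term y (i, j)"
  by (simp add: double_term_def power_mult_distrib)

text \<open>Raising \<open>i\<close> adds 2i + 2j + 1 to the exponent of \<open>q\<close>. The
  weight \<open>q ^ (2 * j)\<close> completes this to 2(i + 2j) + 1, and i + 2j is the degree in
  \<open>y\<close>, so the extra power amounts to replacing \<open>y\<close> by
  \<open>q\<^sup>2 * y\<close>.\<close>

lemma double_term_Suc_left:
  "q ^ (2 * j) * (1 - q * q ^ i) * double_term y (Suc i, j) = x * q * y * double_term (q\<^sup>2 * y) (i, j)"
proof -
  have e: "(Suc i)\<^sup>2 + 2 * Suc i * j + 2 * j\<^sup>2 + j = i\<^sup>2 + 2 * i * j + 2 * j\<^sup>2 + j + (2 * i + 2 * j + 1)"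
    by (simp add: power2_eq_square)
  have 1: "double_term y (Suc i, j) = x * y * q ^ (2 * i + 2 * j + 1) * double_term y (i, j) / (1 - q * q ^ i)"
    unfolding double_term_def prod.case e qpoch_Suc power_add[of q _ "2 * i + 2 * j + 1"]
    by (simp add: mult_ac)
  have 2: "q ^ (2 * j) * q ^ (2 * i + 2 * j + 1) = q * (q\<^sup>2) ^ (i + 2 * j)"
    by (simp add: algebra_simps flip: power_mult power_add)
  have "q ^ (2 * j) * (1 - q * q ^ i) * double_term y (Suc i, j)
      = x * y * (q ^ (2 * j) * q ^ (2 * i + 2 * j + 1)) * double_term y (i, j)"
    unfolding 1 using one_minus_power_Suc_neq_0[OF q, of i] by simp
  then show ?thesis
    unfolding 2 double_term_mult by (simp add: mult_ac)
qed

text \<open>Raising \<open>j\<close> adds 2(i + 2j) + 3 to the exponent of \<open>q\<close>, already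
  twice the degree in \<open>y\<close> plus a constant, so no weight is required.\<close>

lemma double_term_Suc_right:
  "(1 - q\<^sup>2 * (q\<^sup>2) ^ j) * double_term y (i, Suc j) = x * q ^ 3 * y\<^sup>2 * double_term (q\<^sup>2 * y) (i, j)"
proof -
  have e: "i\<^sup>2 + 2 * i * Suc j + 2 * (Suc j)\<^sup>2 + Suc j
      = i\<^sup>2 + 2 * i * j + 2 * j\<^sup>2 + j + (2 * (i + 2 * j) + 3)"
    by (simp add: power2_eq_square)
  have "double_term y (i, Suc j)
      = x * y\<^sup>2 * q ^ (2 * (i + 2 * j) + 3) * double_term y (i, j) / (1 - q\<^sup>2 * (q\<^sup>2) ^ j)"
    unfolding double_term_def prod.case e qpoch_Suc power_add[of q _ "2 * (i + 2 * j) + 3"]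
    by (simp add: mult_ac power2_eq_square)
  moreover have "q ^ (2 * (i + 2 * j) + 3) = q ^ 3 * (q\<^sup>2) ^ (i + 2 * j)"
    by (simp add: add.commute flip: power_mult power_add)
  ultimately show ?thesis
    using one_minus_power_Suc_neq_0[OF norm_q2, of j] by (simp add: double_term_mult)
qed

lemma double_rec: "double y = double (q * y) + x * q * y * (1 + q\<^sup>2 * y) * double (q\<^sup>2 * y)"
proof -
  \<comment> \<open>Weighting the factor for \<open>i\<close> by \<open>q ^ (2 * j)\<close> rather than the one for \<open>j\<close> by \<open>q ^ i\<close>
    is what turns both parts into multiples of \<open>double (q\<^sup>2 * y)\<close>.\<close>
  define L where "L = (\<lambda>(i, j). q ^ (2 * j) * (1 - q ^ i) * double_term y (i, j))"
  define R where "R = (\<lambda>(i, j). (1 - (q\<^sup>2) ^ j) * double_term y (i, j))"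
  have L_Suc: "L (map_prod Suc id p) = x * q * y * double_term (q\<^sup>2 * y) p" for p
    by (cases p) (simp add: L_def double_term_Suc_left)
  have R_Suc: "R (map_prod id Suc p) = x * q ^ 3 * y\<^sup>2 * double_term (q\<^sup>2 * y) p" for p
    by (cases p) (simp add: R_def double_term_Suc_right)
  have "((\<lambda>p. L (map_prod Suc id p)) has_sum x * q * y * double (q\<^sup>2 * y)) UNIV"
    using has_sum_cmult_right[OF double_has_sum[of "q\<^sup>2 * y"], of "x * q * y"]
    by (simp add: L_Suc)
  then have "(L has_sum x * q * y * double (q\<^sup>2 * y)) (range (map_prod Suc id))"
    by (subst has_sum_reindex) (auto simp: inj_on_def o_def)
  \<comment> \<open>The shift misses only the pairs with \<open>i = 0\<close>, where the factor
    \<open>1 - q ^ i\<close> vanishes.\<close>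
  also have "?this \<longleftrightarrow> (L has_sum x * q * y * double (q\<^sup>2 * y)) UNIV"
  proof (rule has_sum_cong_neutral)
    fix p assume "p \<in> UNIV - range (map_prod Suc (id :: nat \<Rightarrow> nat))"
    then have "fst p = 0"
      by (cases p; cases "fst p") (auto simp: image_iff)
    then show "L p = 0"
      by (simp add: L_def case_prod_unfold)
  qed auto
  finally have L: "(L has_sum x * q * y * double (q\<^sup>2 * y)) UNIV" .
  have "((\<lambda>p. R (map_prod id Suc p)) has_sum x * q ^ 3 * y\<^sup>2 * double (q\<^sup>2 * y)) UNIV"
    using has_sum_cmult_right[OF double_has_sum[of "q\<^sup>2 * y"], of "x * q ^ 3 * y\<^sup>2"]
    by (simp add: R_Suc)
  then have "(R has_sum x * q ^ 3 * y\<^sup>2 * double (q\<^sup>2 * y)) (range (map_prod id Suc))"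
    by (subst has_sum_reindex) (auto simp: inj_on_def o_def)
  also have "?this \<longleftrightarrow> (R has_sum x * q ^ 3 * y\<^sup>2 * double (q\<^sup>2 * y)) UNIV"
  proof (rule has_sum_cong_neutral)
    fix p assume "p \<in> UNIV - range (map_prod (id :: nat \<Rightarrow> nat) Suc)"
    then have "snd p = 0"
      by (cases p; cases "snd p") (auto simp: image_iff)
    then show "R p = 0"
      by (simp add: R_def case_prod_unfold)
  qed auto
  finally have R: "(R has_sum x * q ^ 3 * y\<^sup>2 * double (q\<^sup>2 * y)) UNIV" .
  \<comment> \<open>This is 1 - q^(i+2j) = q^(2j) (1 - q^i) + (1 - q^(2j)), multiplied by the term
    at \<open>y\<close>.\<close>
  have "double_term y p = double_term (q * y) p + (L p + R p)" for p
  proof -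
    obtain i j where p: "p = (i, j)" by (cases p)
    have "double_term (q * y) p = q ^ i * q ^ (2 * j) * double_term y p"
      by (simp add: p double_term_mult power_add)
    then show ?thesis
      by (simp add: p L_def R_def algebra_simps flip: power_mult)
  qed
  then have "(double_term y has_sum
      double (q * y) + (x * q * y * double (q\<^sup>2 * y) + x * q ^ 3 * y\<^sup>2 * double (q\<^sup>2 * y))) UNIV"
    using has_sum_add[OF double_has_sum[of "q * y"] has_sum_add[OF L R]] by presburger
  from has_sum_unique[OF double_has_sum this] show ?thesis
    by (simp add: algebra_simps power2_eq_square power3_eq_cube)
qed

text \<open>Every term except the one at \<open>(0, 0)\<close>, which is 1, has degree at least 1 in
  \<open>y\<close> and so gains at least \<open>n\<close> factors \<open>q\<close>. The rest of the
  sum is thus at most \<open>norm q ^ n\<close> times a constant.\<close>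

lemma double_tendsto_1: "(\<lambda>n. double (q ^ n * y)) \<longlonglongrightarrow> 1"
proof -
  define M where "M = (\<Sum>\<^sub>\<infinity>p. norm (double_term y p))"
  have bound: "norm (double (q ^ n * y) - 1) \<le> norm q ^ n * M" for n
  proof (rule norm_infsum_le)
    \<comment> \<open>Subtracting 1 as a family supported at \<open>(0, 0)\<close> allows a termwise
      comparison.\<close>
    have "((\<lambda>p. if p = (0, 0) then -1 else 0) has_sum (-1 :: complex)) (UNIV :: (nat \<times> nat) set)"
      by (rule has_sum_finite_neutralI[of "{(0, 0)}"]) auto
    from has_sum_add[OF double_has_sum this]
    show "((\<lambda>p. double_term (q ^ n * y) p + (if p = (0, 0) then -1 else 0))
        has_sum double (q ^ n * y) - 1) UNIV" by simp
    show "((\<lambda>p. norm q ^ n * norm (double_term y p)) has_sum norm q ^ n * M) UNIV"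
      unfolding M_def
      by (intro has_sum_cmult_right has_sum_infsum double_term_abs_summable)
    fix p :: "nat \<times> nat"
    obtain i j where p: "p = (i, j)" by (cases p)
    show "norm (double_term (q ^ n * y) p + (if p = (0, 0) then -1 else 0))
        \<le> norm q ^ n * norm (double_term y p)"
    proof (cases "p = (0, 0)")
      case False
      then have "n \<le> n * (i + 2 * j)"
        using p by (cases "i + 2 * j") auto
      then have "norm q ^ (n * (i + 2 * j)) \<le> norm q ^ n"
        using q by (intro power_decreasing) auto
      moreover have "double_term (q ^ n * y) p = q ^ (n * (i + 2 * j)) * double_term y p"
        by (simp add: p double_term_mult power_mult)
      ultimately show ?thesis
        using False by (simp add: norm_mult norm_power mult_right_mono)
    qed (simp add: double_term_def)
  qed
  have "(\<lambda>n. norm q ^ n * M) \<longlonglongrightarrow> 0"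
    using q by (intro tendsto_mult_left_zero LIMSEQ_power_zero) auto
  then have "(\<lambda>n. double (q ^ n * y) - 1) \<longlonglongrightarrow> 0"
    by (rule Lim_null_comparison[OF always_eventually, rotated]) (use bound in auto)
  then show ?thesis
    by (simp add: LIM_zero_iff)
qed

section \<open>Equality of the two sides\<close>

lemma double_eq_qpoch_inf_mult_single:
  assumes y: "summable (\<lambda>n. single_coeff n * y ^ n)"
  shows "double y = qpoch_inf (- y * q) q * single y"
proof -
  define G where "G = (\<lambda>z. qpoch_inf (- z * q) q * single z)"
  define a where "a = (\<lambda>n. double (q ^ n * y) - G (q ^ n * y))"
  define c where "c = (\<lambda>n. x * q * (q ^ n * y) * (1 + q\<^sup>2 * (q ^ n * y)))"
  have G_rec: "G z = G (q * z) + x * q * z * (1 + q\<^sup>2 * z) * G (q\<^sup>2 * z)"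
    if "summable (\<lambda>n. single_coeff n * z ^ n)" for z
  proof -
    \<comment> \<open>The first factor peeled off the product is the \<open>1 + q * z\<close> on the
      left of \<open>single_rec\<close>; the second becomes the \<open>1 + q\<^sup>2 * z\<close> of
      the common equation.\<close>
    have 1: "qpoch_inf (- z * q) q = (1 + q * z) * qpoch_inf (- (q * z) * q) q"
      using qpoch_inf_rec[OF q, of "- z * q"] by (simp add: mult_ac)
    have 2: "qpoch_inf (- (q * z) * q) q = (1 + q\<^sup>2 * z) * qpoch_inf (- (q\<^sup>2 * z) * q) q"
      using qpoch_inf_rec[OF q, of "- (q * z) * q"] by (simp add: mult_ac power2_eq_square)
    have "G z = qpoch_inf (- (q * z) * q) q * ((1 + q * z) * single z)"
      unfolding G_def 1 by (simp add: mult_ac)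
    also have "\<dots> = G (q * z) + x * q * z * (qpoch_inf (- (q * z) * q) q * single (q\<^sup>2 * z))"
      unfolding single_rec[OF that] G_def by (simp add: algebra_simps)
    also have "qpoch_inf (- (q * z) * q) q * single (q\<^sup>2 * z) = (1 + q\<^sup>2 * z) * G (q\<^sup>2 * z)"
      unfolding 2 G_def by (simp add: mult_ac)
    finally show ?thesis by (simp add: mult_ac)
  qed
  have "a 0 = 0"
  proof (rule second_order_recurrence_zero)
    fix n
    let ?z = "q ^ n * y"
    have "a n = (double (q * ?z) - G (q * ?z))
        + c n * (double (q\<^sup>2 * ?z) - G (q\<^sup>2 * ?z))"
      unfolding a_def c_def
      by (subst double_rec, subst G_rec[OF summable_single_mult_q_power[OF y]])
        (simp add: algebra_simps)
    then show "a n = a (Suc n) + c n * a (Suc (Suc n))"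
      by (simp add: a_def power2_eq_square mult.assoc)
  next
    show "summable (\<lambda>n. norm (c n))"
    \<comment> \<open>\<open>c n\<close> decays like \<open>norm q ^ n\<close> through its factor
      \<open>q ^ n * y\<close>; its last factor stays bounded.\<close>
    proof (rule summable_comparison_test')
      show "summable (\<lambda>n. norm q ^ n * (norm (x * q * y) * (1 + norm (q\<^sup>2 * y))))"
        using q by (intro summable_mult2 summable_geometric) auto
      fix n
      have "norm (1 + q\<^sup>2 * (q ^ n * y)) \<le> 1 + norm q ^ n * norm (q\<^sup>2 * y)"
        using norm_triangle_ineq[of 1 "q\<^sup>2 * (q ^ n * y)"] by (simp add: norm_mult norm_power mult_ac)
      also have "\<dots> \<le> 1 + norm (q\<^sup>2 * y)"
        using q by (simp add: mult_left_le_one_le power_le_one)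
      finally have "norm (1 + q\<^sup>2 * (q ^ n * y)) \<le> 1 + norm (q\<^sup>2 * y)" .
      then have "norm (x * q * (q ^ n * y)) * norm (1 + q\<^sup>2 * (q ^ n * y))
          \<le> norm (x * q * (q ^ n * y)) * (1 + norm (q\<^sup>2 * y))"
        by (intro mult_left_mono) auto
      then show "norm (norm (c n)) \<le> norm q ^ n * (norm (x * q * y) * (1 + norm (q\<^sup>2 * y)))"
        by (simp add: c_def norm_mult norm_power mult_ac)
    qed
  next
    have "(\<lambda>n. - (q ^ n * y) * q) \<longlonglongrightarrow> 0"
      using tendsto_mult_left_zero[OF tendsto_minus[OF q_power_mult_tendsto_0[of y], simplified], of q]
      by simp
    then have "(\<lambda>n. G (q ^ n * y)) \<longlonglongrightarrow> 1 * 1"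
      unfolding G_def by (intro tendsto_mult qpoch_inf_tendsto_1 q single_tendsto_1 y)
    from tendsto_diff[OF double_tendsto_1 this] show "a \<longlonglongrightarrow> 0"
      by (simp add: a_def)
  qed
  then show ?thesis
    by (simp add: a_def G_def)
qed

end

theorem theorem1p1:
  fixes x y q :: complex
  assumes "norm q < 1"
    and "summable (\<lambda>n. (-1) ^ n * y ^ n * q ^ n * qpoch x (q\<^sup>2) n / qpoch q q n)"
  shows "((\<lambda>(i, j). x ^ (i + j) * y ^ (i + 2 * j) * q ^ (i\<^sup>2 + 2 * i * j + 2 * j\<^sup>2 + j)
            / (qpoch q q i * qpoch (q\<^sup>2) (q\<^sup>2) j))
          has_sum
          (qpoch_inf (- y * q) q *
             (\<Sum>n. (-1) ^ n * y ^ n * q ^ n * qpoch x (q\<^sup>2) n / qpoch q q n)))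
         (UNIV :: (nat \<times> nat) set)"
proof -
  interpret q_series x q
    by unfold_locales fact
  have eq: "(\<lambda>n. (-1) ^ n * y ^ n * q ^ n * qpoch x (q\<^sup>2) n / qpoch q q n)
      = (\<lambda>n. single_coeff n * y ^ n)"
    by (simp add: single_coeff_def fun_eq_iff)
  have "double y = qpoch_inf (- y * q) q * single y"
    using assms(2) unfolding eq by (rule double_eq_qpoch_inf_mult_single)
  with double_has_sum[of y] show ?thesis
    unfolding eq double_term_def single_def by simp
qed

end
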